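(* Let $\mathcal X=(\Omega,S)$ be a quasi-thin scheme with $|S^\perp|\ge 2$. Suppose that for every scheme $\mathcal X'=(\Omega',S')$, every algebraic isomorphism $\varphi:\mathcal X\to\mathcal X'$ and every pair of points $\alpha\in\Omega$, $\alpha'\in\Omega'$, there exists a one point extension $\varphi_{\alpha,\alpha'}:\mathcal X_\alpha\to\mathcal X'_{\alpha'}$ of $\varphi$. Then $\mathcal X$ is schurian and separable.
   Context: A coherent configuration is a pair $(\Omega,S)$ with $\Omega$ finite and $S$ a partition of $\Omega\times\Omega$ such that $1_\Omega$ is a union of elements of $S$, $S$ is closed under transposition $r\mapsto r^*$, and for $u,v,w\in S$ the number $c_{uv}^w=|\alpha u\cap\gamma v^*|$ is independent of $(\alpha,\gamma)\in w$; it is a scheme if $1_\Omega\in S$. Quasi-thin: every basic relation has valency $|\alpha u|\in\{1,2\}$; $S_2$ is the set of valency-$2$ relations. For $u\in S_2$ there is a unique basic relation $u^\perp$ such that $\{1_\Omega,u^\perp\}$ is the set of basic relations contained in $u\cdot u^*$; $S^\perp=\{u^\perp:u\in S_2\}$. An algebraic isomorphism $\varphi:(\Omega,S)\to(\Omega',S')$ is a bijection $S\to S'$ with $c_{uv}^w=c_{\varphi(u)\varphi(v)}^{\varphi(w)}$. For $\alpha\in\Omega$, $\mathcal X_\alpha=(\Omega,S_\alpha)$ is the smallest coherent configuration on $\Omega$ with $1_\alpha=\{(\alpha,\alpha)\}\in S_\alpha$ and every element of $S$ a union of elements of $S_\alpha$. A one point extension of $\varphi$ at $(\alpha,\alpha')$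 is an algebraic isomorphism $\varphi':\mathcal X_\alpha\to\mathcal X'_{\alpha'}$ with $\varphi'(1_\alpha)=1_{\alpha'}$ and $\varphi'(u)\subseteq\varphi(\tilde u)$ for all $u\in S_\alpha$, where $\tilde u$ is the basic relation of $\mathcal X$ containing $u$. Schurian: basic relations are the orbits on $\Omega\times\Omega$ of some permutation group on $\Omega$. Separable: every algebraic isomorphism from the configuration to any coherent configuration is induced by a bijection $f$ of point sets with $u^f=\varphi(u)$ for all basic $u$. *)

theory Defs
  imports "HOL-Library.Disjoint_Sets" "HOL-Algebra.Bij" "HOL-Algebra.Group_Action"
begin

section \<open>Coherent configurations\<close>

text \<open>For a relation \<open>u\<close> and a point \<open>\<alpha>\<close>, the set \<open>\<alpha>u\<close> is \<open>u `` {\<alpha>}\<close>, the transpose \<open>u*\<close> is \<open>u\<inverse>\<close>,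
  and the composition \<open>u \<cdot> v = {(\<alpha>, \<gamma>). \<exists>\<beta>. (\<alpha>, \<beta>) \<in> u \<and> (\<beta>, \<gamma>) \<in> v}\<close> is \<open>u O v\<close>.\<close>

definition is_union_of :: "'a set \<Rightarrow> 'a set set \<Rightarrow> bool" where
  "is_union_of X P \<longleftrightarrow> (\<exists>R \<subseteq> P. X = \<Union>R)"

locale coherent_configuration =
  fixes \<Omega> :: "'a set" and S :: "('a \<times> 'a) set set"
  assumes finite_points: "finite \<Omega>"
    and partition: "partition_on (\<Omega> \<times> \<Omega>) S"
    and diagonal: "is_union_of (Id_on \<Omega>) S"
    and transpose_closed: "u \<in> S \<Longrightarrow> u\<inverse> \<in> S"
    and regular: "\<lbrakk>u \<in> S; v \<in> S; w \<in> S\<rbrakk> \<Longrightarrow>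
      \<exists>n. \<forall>(\<alpha>, \<gamma>) \<in> w. card (u `` {\<alpha>} \<inter> v\<inverse> `` {\<gamma>}) = n"

locale scheme = coherent_configuration +
  assumes diagonal_basic: "Id_on \<Omega> \<in> S"

definition intersection_number ::
    "('a \<times> 'a) set \<Rightarrow> ('a \<times> 'a) set \<Rightarrow> ('a \<times> 'a) set \<Rightarrow> nat" where
  "intersection_number u v w =
     (THE n. \<forall>(\<alpha>, \<gamma>) \<in> w. card (u `` {\<alpha>} \<inter> v\<inverse> `` {\<gamma>}) = n)"

text \<open>In a coherent configuration, \<open>card (u `` {\<alpha>})\<close> does not depend on \<open>\<alpha>\<close> in the domain of the
  basic relation \<open>u\<close>; in a scheme that domain is the whole point set.\<close>

definition valency :: "('a \<times> 'a) set \<Rightarrow> nat" where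
  "valency u = (THE n. \<forall>\<alpha> \<in> Domain u. card (u `` {\<alpha>}) = n)"

definition quasi_thin :: "('a \<times> 'a) set set \<Rightarrow> bool" where
  "quasi_thin S \<longleftrightarrow> (\<forall>u \<in> S. valency u \<in> {1, 2})"

definition valency_two :: "('a \<times> 'a) set set \<Rightarrow> ('a \<times> 'a) set set" where
  "valency_two S = {u \<in> S. valency u = 2}"

definition orthogonal :: "'a set \<Rightarrow> ('a \<times> 'a) set set \<Rightarrow> ('a \<times> 'a) set \<Rightarrow> ('a \<times> 'a) set" where
  "orthogonal \<Omega> S u = (THE v. v \<in> S \<and> {w \<in> S. w \<subseteq> u O u\<inverse>} = {Id_on \<Omega>, v})"

definition orthogonals :: "'a set \<Rightarrow> ('a \<times> 'a) set set \<Rightarrow> ('a \<times> 'a) set set" where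
  "orthogonals \<Omega> S = orthogonal \<Omega> S ` valency_two S"


section \<open>Algebraic isomorphisms and one point extensions\<close>

definition algebraic_isomorphism ::
    "('a \<times> 'a) set set \<Rightarrow> ('b \<times> 'b) set set \<Rightarrow> (('a \<times> 'a) set \<Rightarrow> ('b \<times> 'b) set) \<Rightarrow> bool" where
  "algebraic_isomorphism S S' \<phi> \<longleftrightarrow>
     bij_betw \<phi> S S' \<and>
     (\<forall>u \<in> S. \<forall>v \<in> S. \<forall>w \<in> S.
        intersection_number u v w = intersection_number (\<phi> u) (\<phi> v) (\<phi> w))"

definition point_fixing_refinement ::
    "'a set \<Rightarrow> ('a \<times> 'a) set set \<Rightarrow> 'a \<Rightarrow> ('a \<times> 'a) set set \<Rightarrow> bool" where
  "point_fixing_refinement \<Omega> S \<alpha> T \<longleftrightarrow>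
     coherent_configuration \<Omega> T \<and> {(\<alpha>, \<alpha>)} \<in> T \<and> (\<forall>u \<in> S. is_union_of u T)"

text \<open>Coherent configurations on \<open>\<Omega>\<close> are ordered by \<open>T \<le> T'\<close> iff every element of \<open>T\<close> is a union of
  elements of \<open>T'\<close>, so that the smallest one is the coarsest.\<close>

definition point_extension ::
    "'a set \<Rightarrow> ('a \<times> 'a) set set \<Rightarrow> 'a \<Rightarrow> ('a \<times> 'a) set set" where
  "point_extension \<Omega> S \<alpha> =
     (THE T. point_fixing_refinement \<Omega> S \<alpha> T \<and>
        (\<forall>T'. point_fixing_refinement \<Omega> S \<alpha> T' \<longrightarrow> (\<forall>t \<in> T. is_union_of t T')))"

definition one_point_extension ::
    "'a set \<Rightarrow> ('a \<times> 'a) set set \<Rightarrow> 'b set \<Rightarrow> ('b \<times> 'b) set set \<Rightarrow>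
     (('a \<times> 'a) set \<Rightarrow> ('b \<times> 'b) set) \<Rightarrow> 'a \<Rightarrow> 'b \<Rightarrow>
     (('a \<times> 'a) set \<Rightarrow> ('b \<times> 'b) set) \<Rightarrow> bool" where
  "one_point_extension \<Omega> S \<Omega>' S' \<phi> \<alpha> \<alpha>' \<psi> \<longleftrightarrow>
     algebraic_isomorphism (point_extension \<Omega> S \<alpha>) (point_extension \<Omega>' S' \<alpha>') \<psi> \<and>
     \<psi> {(\<alpha>, \<alpha>)} = {(\<alpha>', \<alpha>')} \<and>
     (\<forall>u \<in> point_extension \<Omega> S \<alpha>. \<forall>v \<in> S. u \<subseteq> v \<longrightarrow> \<psi> u \<subseteq> \<phi> v)"


section \<open>Schurian and separable configurations\<close>

definition schurian :: "'a set \<Rightarrow> ('a \<times> 'a) set set \<Rightarrow> bool" where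
  "schurian \<Omega> S \<longleftrightarrow>
     (\<exists>G. subgroup G (BijGroup \<Omega>) \<and>
          S = orbits (BijGroup \<Omega>\<lparr>carrier := G\<rparr>) (\<Omega> \<times> \<Omega>) (\<lambda>g. map_prod g g))"

text \<open>The type argument is the type of points of the target configurations. Since it is a type
  variable, a theorem with conclusion \<open>separable TYPE('b) \<Omega> S\<close> covers all targets.\<close>

definition separable :: "'b itself \<Rightarrow> 'a set \<Rightarrow> ('a \<times> 'a) set set \<Rightarrow> bool" where
  "separable (_ :: 'b itself) \<Omega> S \<longleftrightarrow>
     (\<forall>(\<Omega>' :: 'b set) S' \<phi>.
        coherent_configuration \<Omega>' S' \<longrightarrow> algebraic_isomorphism S S' \<phi> \<longrightarrow>
        (\<exists>f. bij_betw f \<Omega> \<Omega>' \<and> (\<forall>u \<in> S. map_prod f f ` u = \<phi> u)))"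


section \<open>Existence of the point extension\<close>

lemma is_union_of_iff:
  assumes "partition_on A P"
  shows "is_union_of X P \<longleftrightarrow> X \<subseteq> A \<and> (\<forall>p \<in> P. p \<subseteq> X \<or> p \<inter> X = {})"
proof
  assume "is_union_of X P"
  then obtain R where R: "R \<subseteq> P" "X = \<Union>R" unfolding is_union_of_def by blast
  have "p \<subseteq> X \<or> p \<inter> X = {}" if "p \<in> P" for p
  proof (cases "p \<in> R")
    case False
    have "p \<inter> q = {}" if "q \<in> R" for q
      using partition_onD2[OF assms] \<open>p \<in> P\<close> that R(1) False
      by (metis disjointD subsetD)
    then show ?thesis using R(2) by blast
  qed (use R in blast)
  then show "X \<subseteq> A \<and> (\<forall>p \<in> P. p \<subseteq> X \<or> p \<inter> X = {})"
    using R partition_onD1[OF assms] by blast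
next
  assume X: "X \<subseteq> A \<and> (\<forall>p \<in> P. p \<subseteq> X \<or> p \<inter> X = {})"
  have "X = \<Union>{p \<in> P. p \<subseteq> X}"
  proof (rule equalityI; rule subsetI)
    fix x assume "x \<in> X"
    then obtain p where "p \<in> P" "x \<in> p" using X partition_onD1[OF assms] by blast
    then show "x \<in> \<Union>{p \<in> P. p \<subseteq> X}" using X \<open>x \<in> X\<close> by blast
  qed blast
  then show "is_union_of X P" unfolding is_union_of_def by (metis (lifting) mem_Collect_eq subsetI)
qed

lemma is_union_of_antisym:
  assumes P: "partition_on A P" and Q: "partition_on A Q"
    and PQ: "\<forall>p \<in> P. is_union_of p Q" and QP: "\<forall>q \<in> Q. is_union_of q P"
  shows "P = Q"
proof -
  have "p \<in> Q" if P: "partition_on A P" and Q: "partition_on A Q"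
    and PQ: "\<forall>p \<in> P. is_union_of p Q" and QP: "\<forall>q \<in> Q. is_union_of q P" and p: "p \<in> P"
    for P Q :: "'a set set" and p
  proof -
    obtain x where x: "x \<in> p" using partition_onD3[OF P] p by fastforce
    then have "x \<in> \<Union>Q" using p partition_onD1[OF P] partition_onD1[OF Q] by blast
    then obtain q where q: "q \<in> Q" "x \<in> q" by blast
    have "q \<subseteq> p" using PQ p q x is_union_of_iff[OF Q] by blast
    moreover have "p \<subseteq> q" using QP p q x is_union_of_iff[OF P] by blast
    ultimately have "p = q" by (rule subset_antisym[rotated])
    then show ?thesis using q(1) by simp
  qed
  from this[OF P Q PQ QP] this[OF Q P QP PQ] show ?thesis by (intro subset_antisym subsetI)
qed

lemma coherent_configuration_discrete:
  assumes "finite \<Omega>"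
  shows "coherent_configuration \<Omega> ((\<lambda>x. {x}) ` (\<Omega> \<times> \<Omega>))"
proof
  show "partition_on (\<Omega> \<times> \<Omega>) ((\<lambda>x. {x}) ` (\<Omega> \<times> \<Omega>))" by (rule partition_on_singletons)
  then show "is_union_of (Id_on \<Omega>) ((\<lambda>x. {x}) ` (\<Omega> \<times> \<Omega>))" by (auto simp: is_union_of_iff)
qed (use assms in auto)

lemma (in coherent_configuration) regular_unions:
  assumes u: "is_union_of u S" and v: "is_union_of v S" and w: "w \<in> S"
    and "(\<alpha>, \<gamma>) \<in> w" "(\<alpha>', \<gamma>') \<in> w"
  shows "card (u `` {\<alpha>} \<inter> v\<inverse> `` {\<gamma>}) = card (u `` {\<alpha>'} \<inter> v\<inverse> `` {\<gamma>'})"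
proof -
  obtain P where P: "P \<subseteq> S" "u = \<Union>P" using u unfolding is_union_of_def by blast
  obtain Q where Q: "Q \<subseteq> S" "v = \<Union>Q" using v unfolding is_union_of_def by blast
  have finS: "finite S" using finite_elements[OF _ partition] finite_points by blast
  have fin: "finite (p `` {a})" if "p \<in> S" for p a
  proof -
    have "p `` {a} \<subseteq> \<Omega>" using that partition_onD1[OF partition] by blast
    then show ?thesis using finite_points finite_subset by blast
  qed
  have disj: "x = y" if "x \<in> S" "y \<in> S" "z \<in> x" "z \<in> y" for x y z
    using that partition_onD2[OF partition] by (meson disjointD disjoint_iff)
  have *: "card (u `` {a} \<inter> v\<inverse> `` {c}) =
      (\<Sum>(p, q) \<in> P \<times> Q. card (p `` {a} \<inter> q\<inverse> `` {c}))" for a c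
  proof -
    have "u `` {a} \<inter> v\<inverse> `` {c} = (\<Union>(p, q) \<in> P \<times> Q. p `` {a} \<inter> q\<inverse> `` {c})"
      using P Q by auto
    moreover have "card (\<Union>(p, q) \<in> P \<times> Q. p `` {a} \<inter> q\<inverse> `` {c}) =
        (\<Sum>z \<in> P \<times> Q. card (case z of (p, q) \<Rightarrow> p `` {a} \<inter> q\<inverse> `` {c}))"
    proof (rule card_UN_disjoint)
      show "finite (P \<times> Q)" using P Q finS finite_subset by blast
      show "\<forall>i\<in>P \<times> Q. finite (case i of (p, q) \<Rightarrow> p `` {a} \<inter> q\<inverse> `` {c})"
        using P fin by auto
      show "\<forall>i\<in>P \<times> Q. \<forall>j\<in>P \<times> Q. i \<noteq> j \<longrightarrow>
          (case i of (p, q) \<Rightarrow> p `` {a} \<inter> q\<inverse> `` {c}) \<inter>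
          (case j of (p, q) \<Rightarrow> p `` {a} \<inter> q\<inverse> `` {c}) = {}"
        using P(1) Q(1) disj by (auto; blast)
    qed
    ultimately show ?thesis by (simp add: case_prod_beta)
  qed
  show ?thesis unfolding *
  proof (rule sum.cong)
    fix z assume "z \<in> P \<times> Q"
    then obtain p q where z: "z = (p, q)" "p \<in> S" "q \<in> S" using P Q by auto
    obtain n where n: "\<forall>(\<alpha>, \<gamma>) \<in> w. card (p `` {\<alpha>} \<inter> q\<inverse> `` {\<gamma>}) = n"
      using regular[OF z(2,3) w] by blast
    then have "card (p `` {\<alpha>} \<inter> q\<inverse> `` {\<gamma>}) = card (p `` {\<alpha>'} \<inter> q\<inverse> `` {\<gamma>'})"
      using bspec[OF n assms(4)] bspec[OF n assms(5)] by simp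
    then show "(case z of (p, q) \<Rightarrow> card (p `` {\<alpha>} \<inter> q\<inverse> `` {\<gamma>})) =
        (case z of (p, q) \<Rightarrow> card (p `` {\<alpha>'} \<inter> q\<inverse> `` {\<gamma>'}))"
      using z(1) by simp
  qed simp
qed

lemma point_fixing_refinement_least:
  assumes cc: "coherent_configuration \<Omega> S" and \<alpha>: "\<alpha> \<in> \<Omega>"
  shows "\<exists>!T. point_fixing_refinement \<Omega> S \<alpha> T \<and>
    (\<forall>T'. point_fixing_refinement \<Omega> S \<alpha> T' \<longrightarrow> (\<forall>t \<in> T. is_union_of t T'))"
proof -
  interpret S: coherent_configuration \<Omega> S by fact
  define F where "F = {T. point_fixing_refinement \<Omega> S \<alpha> T}"
  have F: "coherent_configuration \<Omega> T" "{(\<alpha>, \<alpha>)} \<in> T" "\<And>u. u \<in> S \<Longrightarrow> is_union_of u T"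
    "partition_on (\<Omega> \<times> \<Omega>) T" if "T \<in> F" for T
    using that coherent_configuration.partition
    unfolding F_def point_fixing_refinement_def by auto
  define D where "D = (\<lambda>x. {x}) ` (\<Omega> \<times> \<Omega>)"
  have D: "coherent_configuration \<Omega> D"
    unfolding D_def by (rule coherent_configuration_discrete[OF S.finite_points])
  have DF: "D \<in> F"
    unfolding F_def point_fixing_refinement_def mem_Collect_eq
  proof (intro conjI ballI)
    show "{(\<alpha>, \<alpha>)} \<in> D" using \<alpha> unfolding D_def by blast
    fix u assume "u \<in> S"
    then have "u \<subseteq> \<Omega> \<times> \<Omega>" using partition_onD1[OF S.partition] by blast
    moreover have "p \<subseteq> u \<or> p \<inter> u = {}" if "p \<in> D" for p using that unfolding D_def by blast
    ultimately show "is_union_of u D"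
      unfolding is_union_of_iff[OF coherent_configuration.partition[OF D]] by blast
  qed (rule D)
  define R where "R = {(p, q). \<exists>T \<in> F. \<exists>t \<in> T. p \<in> t \<and> q \<in> t}"
  have R_I: "(p, q) \<in> R" if "T \<in> F" "t \<in> T" "p \<in> t" "q \<in> t" for p q T t
    unfolding R_def using that by blast
  define E where "E = R\<^sup>+"
  have RS: "R \<subseteq> (\<Omega> \<times> \<Omega>) \<times> (\<Omega> \<times> \<Omega>)"
  proof -
    have "t \<subseteq> \<Omega> \<times> \<Omega>" if "T \<in> F" "t \<in> T" for T t
      using partition_onD1[OF F(4)[OF that(1)]] that(2) by blast
    then show ?thesis unfolding R_def by blast
  qed
  have equivE: "equiv (\<Omega> \<times> \<Omega>) E"
  proof (rule equivI)
    show "E \<subseteq> (\<Omega> \<times> \<Omega>) \<times> (\<Omega> \<times> \<Omega>)" unfolding E_def using RS by (rule trancl_subset_Sigma)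
    have "(x, x) \<in> R" if "x \<in> \<Omega> \<times> \<Omega>" for x
    proof -
      have "{x} \<in> D" using that unfolding D_def by blast
      then show ?thesis using DF unfolding R_def by blast
    qed
    then show "refl_on (\<Omega> \<times> \<Omega>) E" unfolding E_def refl_on_def by (meson r_into_trancl')
    have "sym R" unfolding R_def sym_def by blast
    then show "sym E" unfolding E_def by (rule sym_trancl)
    show "trans E" unfolding E_def by (rule trans_trancl)
  qed
  define T0 where "T0 = (\<Omega> \<times> \<Omega>) // E"
  have part: "partition_on (\<Omega> \<times> \<Omega>) T0"
    unfolding T0_def by (rule partition_on_quotient[OF equivE])
  have E_invariant: "h p = h q" if "(p, q) \<in> E" and h: "\<And>p q. (p, q) \<in> R \<Longrightarrow> h p = h q"
    for p q and h :: "'a \<times> 'a \<Rightarrow> 'c"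
    using that(1) unfolding E_def by (induction rule: trancl_induct) (auto dest: h)
  have T0_E: "(p, q) \<in> E" if "t \<in> T0" "p \<in> t" "q \<in> t" for t p q
    using that quotient_eq_iff[OF equivE] unfolding T0_def by blast
  have T0_F: "is_union_of t T" if "t \<in> T0" "T \<in> F" for t T
  proof -
    have "x \<subseteq> t" if x: "x \<in> T" "p \<in> x" "p \<in> t" for x p
    proof
      fix q assume "q \<in> x"
      then have "(p, q) \<in> E" using x \<open>T \<in> F\<close> unfolding E_def R_def by blast
      then show "q \<in> t" using \<open>p \<in> t\<close> \<open>t \<in> T0\<close> in_quotient_imp_closed[OF equivE]
        unfolding T0_def by blast
    qed
    moreover have "t \<subseteq> \<Omega> \<times> \<Omega>" using \<open>t \<in> T0\<close> partition_onD1[OF part] by blast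
    ultimately show ?thesis unfolding is_union_of_iff[OF F(4)[OF that(2)]] by blast
  qed
  have F_T0: "is_union_of X T0" if X: "X \<subseteq> \<Omega> \<times> \<Omega>" "\<And>T. T \<in> F \<Longrightarrow> is_union_of X T" for X
  proof -
    have R: "p \<in> X \<longleftrightarrow> q \<in> X" if pq: "(p, q) \<in> R" for p q
    proof -
      obtain T t where T: "T \<in> F" "t \<in> T" "p \<in> t" "q \<in> t" using pq unfolding R_def by blast
      have "t \<subseteq> X \<or> t \<inter> X = {}"
        using X(2)[OF T(1)] T(2) unfolding is_union_of_iff[OF F(4)[OF T(1)]] by blast
      then show ?thesis using T by blast
    qed
    have "q \<in> X" if "t \<in> T0" "p \<in> t" "q \<in> t" "p \<in> X" for t p q
      using E_invariant[OF T0_E[OF that(1-3)], of "\<lambda>p. p \<in> X"] R that(4) by blast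
    then show ?thesis unfolding is_union_of_iff[OF part] using X(1) by blast
  qed
  have coh: "coherent_configuration \<Omega> T0"
  proof
    show "finite \<Omega>" by (rule S.finite_points)
    show "partition_on (\<Omega> \<times> \<Omega>) T0" by (rule part)
    show "is_union_of (Id_on \<Omega>) T0"
      using F(1) coherent_configuration.diagonal by (intro F_T0) auto
  next
    fix u assume u: "u \<in> T0"
    have conv: "(prod.swap p, prod.swap q) \<in> R" if "(p, q) \<in> R" for p q
    proof -
      obtain T t where T: "T \<in> F" "t \<in> T" "p \<in> t" "q \<in> t" using \<open>(p, q) \<in> R\<close> unfolding R_def by blast
      have "t\<inverse> \<in> T" by (rule coherent_configuration.transpose_closed[OF F(1)[OF T(1)] T(2)])
      moreover have "prod.swap p \<in> t\<inverse>" using T(3) by (cases p) simp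
      moreover have "prod.swap q \<in> t\<inverse>" using T(4) by (cases q) simp
      ultimately show ?thesis using R_I[OF T(1)] by metis
    qed
    have convE: "(prod.swap p, prod.swap q) \<in> E" if "(p, q) \<in> E" for p q
      using that unfolding E_def
    proof (induction rule: trancl_induct)
      case (base q)
      then show ?case by (intro r_into_trancl conv)
    next
      case (step q r)
      then show ?case by (meson conv trancl_into_trancl)
    qed
    obtain x where x: "x \<in> \<Omega> \<times> \<Omega>" "u = E `` {x}" using u unfolding T0_def by (elim quotientE)
    have "u\<inverse> = E `` {prod.swap x}"
    proof (rule Set.set_eqI)
      fix y
      have "y \<in> u\<inverse> \<longleftrightarrow> prod.swap y \<in> u" by (cases y) auto
      also have "\<dots> \<longleftrightarrow> (x, prod.swap y) \<in> E" unfolding x(2) by simp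
      also have "\<dots> \<longleftrightarrow> (prod.swap x, y) \<in> E"
        using convE[of x "prod.swap y"] convE[of "prod.swap x" y]
        unfolding swap_swap by blast
      finally show "y \<in> u\<inverse> \<longleftrightarrow> y \<in> E `` {prod.swap x}" by simp
    qed
    moreover have "prod.swap x \<in> \<Omega> \<times> \<Omega>" using x by (cases x) auto
    ultimately show "u\<inverse> \<in> T0" unfolding T0_def by (metis quotientI)
  next
    fix u v w assume uvw: "u \<in> T0" "v \<in> T0" "w \<in> T0"
    define h where "h = (\<lambda>p. card (u `` {fst p} \<inter> v\<inverse> `` {snd p}))"
    have hR: "h p = h q" if pq: "(p, q) \<in> R" for p q
    proof -
      obtain T t where T: "T \<in> F" "t \<in> T" "p \<in> t" "q \<in> t" using pq unfolding R_def by blast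
      show ?thesis unfolding h_def
        by (rule coherent_configuration.regular_unions[OF F(1)[OF T(1)]
              T0_F[OF uvw(1) T(1)] T0_F[OF uvw(2) T(1)] T(2)]) (simp_all add: T)
    qed
    obtain p where p: "p \<in> w" using uvw(3) partition_onD3[OF part] by (metis ex_in_conv)
    have "h q = h p" if "q \<in> w" for q
      by (rule E_invariant[OF T0_E[OF uvw(3) that p] hR])
    then show "\<exists>n. \<forall>(\<alpha>, \<gamma>) \<in> w. card (u `` {\<alpha>} \<inter> v\<inverse> `` {\<gamma>}) = n"
      by (intro exI[of _ "h p"]) (auto simp: h_def)
  qed
  have "{(\<alpha>, \<alpha>)} \<in> T0"
  proof -
    obtain t where t: "t \<in> T0" "(\<alpha>, \<alpha>) \<in> t" using partition_onD1[OF part] \<alpha> by blast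
    have "is_union_of {(\<alpha>, \<alpha>)} T0"
    proof (rule F_T0)
      fix T assume "T \<in> F"
      then have "{{(\<alpha>, \<alpha>)}} \<subseteq> T" using F(2) by blast
      moreover have "{(\<alpha>, \<alpha>)} = \<Union>{{(\<alpha>, \<alpha>)}}" by simp
      ultimately show "is_union_of {(\<alpha>, \<alpha>)} T" unfolding is_union_of_def by blast
    qed (use \<alpha> in blast)
    then have "t \<subseteq> {(\<alpha>, \<alpha>)}" unfolding is_union_of_iff[OF part] using t by blast
    then show ?thesis using t by (metis empty_iff subset_singletonD)
  qed
  moreover have "is_union_of u T0" if "u \<in> S" for u
  proof (rule F_T0)
    show "u \<subseteq> \<Omega> \<times> \<Omega>" using that partition_onD1[OF S.partition] by blast
  qed (use that F(3) in blast)
  ultimately have T0: "point_fixing_refinement \<Omega> S \<alpha> T0"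
    using coh unfolding point_fixing_refinement_def by blast
  show ?thesis
  proof (rule ex1I)
    show "point_fixing_refinement \<Omega> S \<alpha> T0 \<and>
      (\<forall>T'. point_fixing_refinement \<Omega> S \<alpha> T' \<longrightarrow> (\<forall>t \<in> T0. is_union_of t T'))"
      using T0 T0_F unfolding F_def by blast
  next
    fix T assume T: "point_fixing_refinement \<Omega> S \<alpha> T \<and>
      (\<forall>T'. point_fixing_refinement \<Omega> S \<alpha> T' \<longrightarrow> (\<forall>t \<in> T. is_union_of t T'))"
    then have "T \<in> F" unfolding F_def by blast
    then show "T = T0"
      using T T0 T0_F by (intro is_union_of_antisym[OF F(4)[OF \<open>T \<in> F\<close>] part]) blast+
  qed
qed

lemma point_extension:
  assumes "coherent_configuration \<Omega> S" and "\<alpha> \<in> \<Omega>"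
  shows "point_fixing_refinement \<Omega> S \<alpha> (point_extension \<Omega> S \<alpha>)"
    and "\<lbrakk>point_fixing_refinement \<Omega> S \<alpha> T; t \<in> point_extension \<Omega> S \<alpha>\<rbrakk> \<Longrightarrow> is_union_of t T"
proof -
  note * = theI'[OF point_fixing_refinement_least[OF assms], folded point_extension_def]
  show "point_fixing_refinement \<Omega> S \<alpha> (point_extension \<Omega> S \<alpha>)" by (rule conjunct1[OF *])
  show "is_union_of t T"
    if "point_fixing_refinement \<Omega> S \<alpha> T" "t \<in> point_extension \<Omega> S \<alpha>"
    using conjunct2[OF *] that by simp
qed

end

theory Submission
  imports Defs
begin

text \<open>In a quasi-thin scheme every basic relation meets \<open>\<alpha>x \<times> \<alpha>y\<close> biregularly, so, these sets having at
  most two points, the permutation that swaps the two points of every two-element set \<open>\<alpha>x\<close> is an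
  automorphism fixing \<open>\<alpha>\<close>. Hence the automorphism group, once transitive, has the basic relations as its
  orbits. The fibres of \<open>\<X>\<^sub>\<alpha>\<close> have at most two points as well; two of them are joined by a single basic
  relation or by two perfect matchings, so an algebraic isomorphism of \<open>\<X>\<^sub>\<alpha>\<close> can be realised point by
  point: the image of a new point is forced as soon as one matching leads to it, and is arbitrary within
  its fibre otherwise. Applied to one point extensions this yields separability, and, for the identity
  on \<open>\<X>\<close>, transitivity.\<close>

section \<open>Basic relations and paths of length two\<close>

context coherent_configuration
begin

lemma basic_subset: "u \<in> S \<Longrightarrow> u \<subseteq> \<Omega> \<times> \<Omega>"
  using partition_onD1[OF partition] by blast

lemma basic_nonempty: "u \<in> S \<Longrightarrow> u \<noteq> {}"
  using partition_onD3[OF partition] by blast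

lemma basic_exists: "\<lbrakk>x \<in> \<Omega>; y \<in> \<Omega>\<rbrakk> \<Longrightarrow> \<exists>w \<in> S. (x, y) \<in> w"
  using partition_onD1[OF partition] by blast

lemma basic_unique: "\<lbrakk>u \<in> S; v \<in> S; p \<in> u; p \<in> v\<rbrakk> \<Longrightarrow> u = v"
  using partition_onD2[OF partition] by (meson disjointD disjoint_iff)

lemma finite_row: "u \<in> S \<Longrightarrow> finite (u `` {a})"
  by (rule finite_subset[OF _ finite_points]) (use basic_subset in blast)

text \<open>The diagonal is a union of basic relations, so a basic relation that meets it cannot
  leave it.\<close>

lemma basic_subset_Id:
  assumes "e \<in> S" "(x, x) \<in> e"
  shows "e \<subseteq> Id_on \<Omega>"
proof -
  have "x \<in> \<Omega>" using assms basic_subset by blast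
  then show ?thesis using assms diagonal unfolding is_union_of_iff[OF partition] by blast
qed

text \<open>Since \<open>w\<close> contains a pair, only one number fits the definite description in
  \<open>intersection_number\<close>.\<close>

lemma card_path:
  assumes "u \<in> S" "v \<in> S" "w \<in> S" "(a, c) \<in> w"
  shows "card (u `` {a} \<inter> v\<inverse> `` {c}) = intersection_number u v w"
proof -
  obtain n where n: "\<forall>(\<alpha>, \<gamma>) \<in> w. card (u `` {\<alpha>} \<inter> v\<inverse> `` {\<gamma>}) = n"
    using regular[OF assms(1-3)] by blast
  then have "intersection_number u v w = n"
    unfolding intersection_number_def using assms(4) by (intro the_equality) fastforce+
  then show ?thesis using n assms(4) by auto
qed

lemma card_path_eq:
  assumes "u \<in> S" "v \<in> S" "w \<in> S" "(a, c) \<in> w" "(a', c') \<in> w"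
  shows "card (u `` {a} \<inter> v\<inverse> `` {c}) = card (u `` {a'} \<inter> v\<inverse> `` {c'})"
  using assms by (simp add: card_path)

text \<open>Closed paths at \<open>a\<close> along \<open>u\<close> and back correspond to the
  points of the row of \<open>a\<close>. The diagonal may split into several basic relations, so
  \<open>e\<close> is the one at \<open>a\<close>.\<close>

lemma card_row:
  assumes "u \<in> S" "e \<in> S" "(a, a) \<in> e"
  shows "card (u `` {a}) = intersection_number u (u\<inverse>) e"
  using card_path[OF assms(1) transpose_closed[OF assms(1)] assms(2,3)] by simp

text \<open>Whether two points are joined by a path of types \<open>u\<close>, \<open>v\<close>
  depends only on their basic relation and is visible in an intersection number, which is what
  algebraic isomorphisms transport.\<close>

lemma path_positive:
  assumes "u \<in> S" "v \<in> S" "w \<in> S" "(a, c) \<in> w"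
  shows "intersection_number u v w > 0 \<longleftrightarrow> (\<exists>b. (a, b) \<in> u \<and> (b, c) \<in> v)"
proof -
  have "finite (u `` {a} \<inter> v\<inverse> `` {c})" using finite_row[OF assms(1)] by blast
  then have "intersection_number u v w > 0 \<longleftrightarrow> u `` {a} \<inter> v\<inverse> `` {c} \<noteq> {}"
    unfolding card_path[OF assms, symmetric] by (simp add: card_gt_0_iff)
  then show ?thesis by blast
qed

lemma path_exists:
  assumes "u \<in> S" "v \<in> S" "w \<in> S" "(a, b) \<in> u" "(b, c) \<in> v" "(a, c) \<in> w" "(a', c') \<in> w"
  shows "\<exists>b'. (a', b') \<in> u \<and> (b', c') \<in> v"
  using path_positive[OF assms(1-3,6)] path_positive[OF assms(1-3,7)] assms by blast

text \<open>This describes the reflexive basic relations through intersection numbers only.\<close>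

lemma subset_Id_iff:
  assumes w: "w \<in> S"
  shows "w \<subseteq> Id \<longleftrightarrow> (\<forall>u \<in> S. \<forall>v \<in> S. intersection_number w u v > 0 \<longrightarrow> u = v)"
proof
  assume L: "w \<subseteq> Id"
  show "\<forall>u \<in> S. \<forall>v \<in> S. intersection_number w u v > 0 \<longrightarrow> u = v"
  proof (intro ballI impI)
    fix u v assume uv: "u \<in> S" "v \<in> S" "intersection_number w u v > 0"
    obtain a c where ac: "(a, c) \<in> v" using basic_nonempty[OF uv(2)] by auto
    then obtain b where "(a, b) \<in> w" "(b, c) \<in> u" using path_positive[OF w uv(1,2) ac] uv(3) by blast
    then have "(a, c) \<in> u" using L by blast
    then show "u = v" using basic_unique uv ac by blast
  qed
next
  assume R: "\<forall>u \<in> S. \<forall>v \<in> S. intersection_number w u v > 0 \<longrightarrow> u = v"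
  obtain x y where xy: "(x, y) \<in> w" using basic_nonempty[OF w] by auto
  then have "y \<in> \<Omega>" using basic_subset w by blast
  then obtain e where e: "e \<in> S" "(y, y) \<in> e" using basic_exists by blast
  \<comment> \<open>Going from \<open>x\<close> to \<open>y\<close> by \<open>w\<close> and then
    along the loop at \<open>y\<close> makes the number of \<open>w\<close>, \<open>e\<close>,
    \<open>w\<close> positive, so \<open>R\<close> identifies \<open>w\<close> with the reflexive
    relation \<open>e\<close>.\<close>
  then have "e = w" using R w path_positive[OF w e(1) w xy] xy by blast
  then show "w \<subseteq> Id" using basic_subset_Id[OF e] by blast
qed

end

section \<open>Algebraic isomorphisms and their realisation by point maps\<close>

locale algebraic_iso = X: coherent_configuration \<Omega> S + Y: coherent_configuration \<Omega>' S'
  for \<Omega> :: "'a set" and S and \<Omega>' :: "'b set" and S' +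
  fixes \<phi> :: "('a \<times> 'a) set \<Rightarrow> ('b \<times> 'b) set"
  assumes iso: "algebraic_isomorphism S S' \<phi>"
begin

lemma bij: "bij_betw \<phi> S S'"
  using iso unfolding algebraic_isomorphism_def by blast

lemma image_basic: "u \<in> S \<Longrightarrow> \<phi> u \<in> S'"
  using bij by (rule bij_betwE[THEN bspec])

lemma number_eq:
  "\<lbrakk>u \<in> S; v \<in> S; w \<in> S\<rbrakk> \<Longrightarrow> intersection_number (\<phi> u) (\<phi> v) (\<phi> w) = intersection_number u v w"
  using iso unfolding algebraic_isomorphism_def by simp

lemma preimage_basic: "u' \<in> S' \<Longrightarrow> \<exists>u \<in> S. \<phi> u = u'"
  using bij unfolding bij_betw_def by blast

lemma basic_inj: "\<lbrakk>u \<in> S; v \<in> S; \<phi> u = \<phi> v\<rbrakk> \<Longrightarrow> u = v"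
  using bij unfolding bij_betw_def inj_on_def by blast

text \<open>Triangles transfer in both directions, because the relevant intersection numbers
  agree.\<close>

lemma path_iff:
  assumes "u \<in> S" "v \<in> S" "w \<in> S" "(a, c) \<in> w" "(a', c') \<in> \<phi> w"
  shows "(\<exists>b'. (a', b') \<in> \<phi> u \<and> (b', c') \<in> \<phi> v) \<longleftrightarrow> (\<exists>b. (a, b) \<in> u \<and> (b, c) \<in> v)"
  using X.path_positive[OF assms(1-4)] assms(5)
    Y.path_positive[OF image_basic[OF assms(1)] image_basic[OF assms(2)] image_basic[OF assms(3)]]
    number_eq[OF assms(1-3)] by metis

text \<open>By \<open>subset_Id_iff\<close> the property is expressed by intersection numbers;
  bijectivity of \<phi> turns the quantifiers over \<open>S'\<close> into quantifiers over
  \<open>S\<close>.\<close>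

lemma image_subset_Id:
  assumes w: "w \<in> S"
  shows "\<phi> w \<subseteq> Id \<longleftrightarrow> w \<subseteq> Id"
proof -
  have "(\<forall>u' \<in> S'. \<forall>v' \<in> S'. intersection_number (\<phi> w) u' v' > 0 \<longrightarrow> u' = v') \<longleftrightarrow>
    (\<forall>u \<in> S. \<forall>v \<in> S. intersection_number (\<phi> w) (\<phi> u) (\<phi> v) > 0 \<longrightarrow> \<phi> u = \<phi> v)"
    using preimage_basic image_basic by metis
  also have "\<dots> \<longleftrightarrow> (\<forall>u \<in> S. \<forall>v \<in> S. intersection_number w u v > 0 \<longrightarrow> u = v)"
    using number_eq w basic_inj by metis
  finally show ?thesis using X.subset_Id_iff[OF w] Y.subset_Id_iff[OF image_basic[OF w]] by blast
qed

text \<open>A closed path along \<open>u\<close> and back transfers to a closed path at a point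
  \<open>a'\<close> with \<open>(a', a')\<close> in \<open>\<phi> e\<close>. Its second step lies in
  both of the basic relations to be compared.\<close>

lemma image_converse:
  assumes u: "u \<in> S"
  shows "\<phi> (u\<inverse>) = (\<phi> u)\<inverse>"
proof -
  obtain a b where ab: "(a, b) \<in> u" using X.basic_nonempty[OF u] by auto
  then have "a \<in> \<Omega>" using X.basic_subset u by blast
  then obtain e where e: "e \<in> S" "(a, a) \<in> e" using X.basic_exists by blast
  have "e \<subseteq> Id" using X.basic_subset_Id[OF e] by blast
  then have Id: "\<phi> e \<subseteq> Id" using image_subset_Id[OF e(1)] by blast
  obtain p where p: "p \<in> \<phi> e" using Y.basic_nonempty[OF image_basic[OF e(1)]] by blast
  then obtain a' where a': "(a', a') \<in> \<phi> e" using Id by (cases p) blast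
  have "\<exists>b'. (a', b') \<in> \<phi> u \<and> (b', a') \<in> \<phi> (u\<inverse>)"
    unfolding path_iff[OF u X.transpose_closed[OF u] e a'] using ab by blast
  then obtain b' where "(a', b') \<in> \<phi> u" "(b', a') \<in> \<phi> (u\<inverse>)" by blast
  then show ?thesis
    using Y.basic_unique[of "\<phi> (u\<inverse>)" "(\<phi> u)\<inverse>" "(b', a')"] image_basic[OF X.transpose_closed[OF u]]
      Y.transpose_closed[OF image_basic[OF u]] by blast
qed

lemma card_row_image:
  assumes "u \<in> S" "e \<in> S" "(a, a) \<in> e" "(a', a') \<in> \<phi> e"
  shows "card (\<phi> u `` {a'}) = card (u `` {a})"
  using assms X.card_row[OF assms(1-3)] Y.card_row[OF image_basic[OF assms(1)] image_basic[OF assms(2)] assms(4)]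
    number_eq[OF assms(1) X.transpose_closed[OF assms(1)] assms(2)] image_converse[OF assms(1)] by simp

text \<open>Let \<open>F = r `` {\<alpha>}\<close> be the fibre of the new point \<open>z\<close>. It contains the row through \<open>z\<close> of every earlier
  point; if one of these rows differs from \<open>F\<close>, it is \<open>{z}\<close> and forces the image of \<open>z\<close>.\<close>

lemma realize_on:
  assumes \<alpha>: "{(\<alpha>, \<alpha>)} \<in> S" and \<alpha>': "\<phi> {(\<alpha>, \<alpha>)} = {(\<alpha>', \<alpha>')}"
    and rows: "\<And>w. w \<in> S \<Longrightarrow> card (w `` {\<alpha>}) \<le> 2"
    and "finite D" "D \<subseteq> \<Omega>"
  shows "\<exists>f. f ` insert \<alpha> D \<subseteq> \<Omega>' \<and>
    (\<forall>x \<in> insert \<alpha> D. \<forall>y \<in> insert \<alpha> D. \<forall>w \<in> S. (x, y) \<in> w \<longrightarrow> (f x, f y) \<in> \<phi> w)"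
  using assms(4,5)
proof (induction D rule: finite_induct)
  case empty
  have "w = {(\<alpha>, \<alpha>)}" if "w \<in> S" "(\<alpha>, \<alpha>) \<in> w" for w
    using X.basic_unique[OF that(1) \<alpha> that(2)] by blast
  moreover have "\<alpha>' \<in> \<Omega>'" using Y.basic_subset[OF image_basic[OF \<alpha>]] \<alpha>' by blast
  ultimately show ?case using \<alpha>' by (intro exI[of _ "\<lambda>_. \<alpha>'"]) auto
next
  case (insert z D)
  have z: "z \<in> \<Omega>" and D: "D \<subseteq> \<Omega>" using insert.prems by auto
  have \<alpha>\<Omega>: "\<alpha> \<in> \<Omega>" using X.basic_subset[OF \<alpha>] by blast
  let ?D = "insert \<alpha> D"
  have D\<Omega>: "x \<in> \<Omega>" if "x \<in> ?D" for x using that D \<alpha>\<Omega> by blast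
  obtain f where f_all: "f ` ?D \<subseteq> \<Omega>' \<and>
      (\<forall>x \<in> ?D. \<forall>y \<in> ?D. \<forall>w \<in> S. (x, y) \<in> w \<longrightarrow> (f x, f y) \<in> \<phi> w)"
    using insert.IH[OF D] by (rule exE)
  then have f: "f ` ?D \<subseteq> \<Omega>'" by (rule conjunct1)
  have fw: "(f x, f y) \<in> \<phi> w" if "x \<in> ?D" "y \<in> ?D" "w \<in> S" "(x, y) \<in> w" for x y w
    using conjunct2[OF f_all] that by (simp only: Ball_def)
  show ?case
  proof (cases "z \<in> ?D")
    case True
    then have "insert \<alpha> (insert z D) = ?D" by blast
    then show ?thesis using f fw by auto
  next
    case False
    have "f \<alpha> = \<alpha>'" using fw[of \<alpha> \<alpha>, OF _ _ \<alpha>] \<alpha>' by blast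
    obtain r where r: "r \<in> S" "(\<alpha>, z) \<in> r" using X.basic_exists[OF \<alpha>\<Omega> z] by blast
    have row_sub: "w `` {y} \<subseteq> r `` {\<alpha>}" if w: "w \<in> S" "(y, z) \<in> w" for y w
    proof
      fix \<beta> assume "\<beta> \<in> w `` {y}"
      have "y \<in> \<Omega>" using X.basic_subset w by blast
      then obtain t where t: "t \<in> S" "(y, \<alpha>) \<in> t" using X.basic_exists \<alpha>\<Omega> by blast
      obtain b where b: "(y, b) \<in> t" "(b, \<beta>) \<in> r"
        using X.path_exists[OF t(1) r(1) w(1) t(2) r(2) w(2), of y \<beta>] \<open>\<beta> \<in> w `` {y}\<close> by blast
      \<comment> \<open>The pair \<open>(\<alpha>, z)\<close> of \<open>r\<close> factors through
        \<open>{(\<alpha>, \<alpha>)}\<close>, so every pair of \<open>r\<close> does; hence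
        \<open>b\<close> is \<alpha>.\<close>
      obtain b' where "(b, b') \<in> {(\<alpha>, \<alpha>)}"
        using X.path_exists[OF \<alpha> r(1) r(1) _ r(2) r(2) b(2)] by blast
      then show "\<beta> \<in> r `` {\<alpha>}" using b by blast
    qed
    have "\<exists>z'. \<forall>x \<in> ?D. \<forall>w \<in> S. (x, z) \<in> w \<longrightarrow> (f x, z') \<in> \<phi> w"
    proof (cases "\<exists>y \<in> ?D. \<exists>w \<in> S. (y, z) \<in> w \<and> w `` {y} \<noteq> r `` {\<alpha>}")
      case True
      then obtain y s where y: "y \<in> ?D" "s \<in> S" "(y, z) \<in> s" "s `` {y} \<noteq> r `` {\<alpha>}" by blast
      have "card (s `` {y}) < card (r `` {\<alpha>})"
        using row_sub[OF y(2,3)] y(4) X.finite_row[OF r(1)] by (intro psubset_card_mono) auto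
      moreover have "card (s `` {y}) \<noteq> 0" using X.finite_row[OF y(2)] y(3) by auto
      ultimately have card1: "card (s `` {y}) = 1" using rows[OF r(1)] by linarith
      obtain e where e: "e \<in> S" "(y, y) \<in> e" using X.basic_exists D\<Omega> y(1) by blast
      have "card (\<phi> s `` {f y}) = 1"
        using card_row_image[OF y(2) e fw[OF y(1) y(1) e]] card1 by simp
      then obtain z' where z': "\<phi> s `` {f y} = {z'}" by (meson card_1_singletonE)
      have "(f x, z') \<in> \<phi> w" if x: "x \<in> ?D" "w \<in> S" "(x, z) \<in> w" for x w
      proof -
        obtain t where t: "t \<in> S" "(x, y) \<in> t" using X.basic_exists D\<Omega> y(1) x(1) by blast
        \<comment> \<open>The triangle \<open>x\<close>, \<open>z\<close>, \<open>y\<close> is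
          carried over: some point reached from \<open>f x\<close> by \<open>\<phi> w\<close> lies
          in the singleton row of \<open>f y\<close>, so it is \<open>z'\<close>.\<close>
        have "\<exists>b'. (f x, b') \<in> \<phi> w \<and> (b', f y) \<in> \<phi> (s\<inverse>)"
          unfolding path_iff[OF x(2) X.transpose_closed[OF y(2)] t fw[OF x(1) y(1) t]]
          using x y by blast
        then obtain b' where b': "(f x, b') \<in> \<phi> w" "b' \<in> \<phi> s `` {f y}"
          unfolding image_converse[OF y(2)] by blast
        then show ?thesis using z' by simp
      qed
      then show ?thesis by blast
    next
      case full: False
      obtain z' where z': "(\<alpha>', z') \<in> \<phi> r"
      proof -
        have "card (\<phi> r `` {\<alpha>'}) = card (r `` {\<alpha>})"
          using card_row_image[OF r(1) \<alpha>] \<alpha>' by blast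
        moreover have "card (r `` {\<alpha>}) \<noteq> 0" using X.finite_row[OF r(1)] r(2) by auto
        ultimately have "\<phi> r `` {\<alpha>'} \<noteq> {}" by force
        then show ?thesis using that by blast
      qed
      have "(f x, z') \<in> \<phi> w" if x: "x \<in> ?D" "w \<in> S" "(x, z) \<in> w" for x w
      proof -
        have "f x \<in> \<Omega>'" using f x(1) by blast
        moreover have "z' \<in> \<Omega>'" using Y.basic_subset[OF image_basic[OF r(1)]] z' by blast
        \<comment> \<open>The image under \<phi> of \<open>v\<close> is the actual relation of
          \<open>f x\<close> to \<open>z'\<close>. Pulling back the triangle with \<alpha>' gives a
          point \<open>b\<close> of the fibre related to \<open>x\<close> by \<open>v\<close>; the
          row of \<open>x\<close> by \<open>w\<close> is the whole fibre, so \<open>b\<close> is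
          related to \<open>x\<close> by \<open>w\<close> too, and \<open>v = w\<close>.\<close>
        ultimately obtain v where v: "v \<in> S" "(f x, z') \<in> \<phi> v"
          using Y.basic_exists preimage_basic by metis
        obtain t where t: "t \<in> S" "(x, \<alpha>) \<in> t" using X.basic_exists D\<Omega> \<alpha>\<Omega> x(1) by blast
        have t': "(f x, \<alpha>') \<in> \<phi> t" using fw[OF x(1) _ t] \<open>f \<alpha> = \<alpha>'\<close> by blast
        have r': "(z', \<alpha>') \<in> \<phi> (r\<inverse>)" unfolding image_converse[OF r(1)] using z' by blast
        have "\<exists>b. (x, b) \<in> v \<and> (b, \<alpha>) \<in> r\<inverse>"
          using path_iff[OF v(1) X.transpose_closed[OF r(1)] t t'] v(2) r' by blast
        then obtain b where b: "(x, b) \<in> v" "b \<in> r `` {\<alpha>}" by blast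
        then have "(x, b) \<in> w" using full x by blast
        then have "v = w" using X.basic_unique v(1) x(2) b(1) by blast
        then show ?thesis using v(2) by simp
      qed
      then show ?thesis by blast
    qed
    then obtain z' where z': "\<And>x w. \<lbrakk>x \<in> ?D; w \<in> S; (x, z) \<in> w\<rbrakk> \<Longrightarrow> (f x, z') \<in> \<phi> w" by blast
    have z'\<Omega>: "z' \<in> \<Omega>'" using z'[OF _ r] Y.basic_subset[OF image_basic[OF r(1)]] by blast
    have zx: "(z', f x) \<in> \<phi> w" if "x \<in> ?D" "w \<in> S" "(z, x) \<in> w" for x w
      using z'[OF that(1) X.transpose_closed[OF that(2)]] that(3) image_converse[OF that(2)] by blast
    \<comment> \<open>The path from \<alpha> to \<open>z\<close> followed by the loop at
      \<open>z\<close> transfers. As \<open>\<phi> w\<close> lies in \<open>Id\<close>, the last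
      step of the transferred path can only be the loop at \<open>z'\<close>.\<close>
    have zz: "(z', z') \<in> \<phi> w" if w: "w \<in> S" "(z, z) \<in> w" for w
    proof -
      have "w \<subseteq> Id" using X.basic_subset_Id[OF w] by blast
      then have Id: "\<phi> w \<subseteq> Id" using image_subset_Id[OF w(1)] by blast
      have "\<exists>b'. (\<alpha>', b') \<in> \<phi> r \<and> (b', z') \<in> \<phi> w"
        using path_iff[OF r(1) w(1) r, of \<alpha>' z'] z'[OF _ r] \<open>f \<alpha> = \<alpha>'\<close> r w by blast
      then show ?thesis using Id by blast
    qed
    let ?f = "f(z := z')"
    have "?f ` insert \<alpha> (insert z D) \<subseteq> \<Omega>'" using f z'\<Omega> by auto
    moreover have "(?f x, ?f y) \<in> \<phi> w"
      if "x \<in> insert \<alpha> (insert z D)" "y \<in> insert \<alpha> (insert z D)" "w \<in> S" "(x, y) \<in> w" for x y w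
    proof -
      have x: "x = z \<or> x \<in> ?D \<and> x \<noteq> z" and y: "y = z \<or> y \<in> ?D \<and> y \<noteq> z"
        using that(1,2) False by auto
      show ?thesis
      proof (cases "x = z")
        case True
        then show ?thesis using y that zx zz by auto
      next
        case xz: False
        then show ?thesis using x y that z' fw by (cases "y = z") auto
      qed
    qed
    ultimately show ?thesis by blast
  qed
qed

text \<open>\<open>realize_on\<close> is applied with all of \<Omega> as domain. Injectivity holds
  because two points with equal images are joined by a basic relation whose image meets the
  diagonal. Surjectivity is left to a count of points.\<close>

lemma realize:
  assumes "{(\<alpha>, \<alpha>)} \<in> S" "\<phi> {(\<alpha>, \<alpha>)} = {(\<alpha>', \<alpha>')}" "\<And>w. w \<in> S \<Longrightarrow> card (w `` {\<alpha>}) \<le> 2"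
  obtains f where "f ` \<Omega> \<subseteq> \<Omega>'" "inj_on f \<Omega>" "f \<alpha> = \<alpha>'"
    "\<And>x y w. \<lbrakk>w \<in> S; (x, y) \<in> w\<rbrakk> \<Longrightarrow> (f x, f y) \<in> \<phi> w"
proof -
  have "insert \<alpha> \<Omega> = \<Omega>" using X.basic_subset[OF assms(1)] by blast
  then obtain f where f: "f ` \<Omega> \<subseteq> \<Omega>'"
    and fw: "\<And>x y w. \<lbrakk>x \<in> \<Omega>; y \<in> \<Omega>; w \<in> S; (x, y) \<in> w\<rbrakk> \<Longrightarrow> (f x, f y) \<in> \<phi> w"
    using realize_on[OF assms X.finite_points subset_refl] by auto
  have fw': "(f x, f y) \<in> \<phi> w" if "w \<in> S" "(x, y) \<in> w" for x y w
    using fw that X.basic_subset by blast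
  have "inj_on f \<Omega>"
  proof (rule inj_onI)
    fix x y assume xy: "x \<in> \<Omega>" "y \<in> \<Omega>" "f x = f y"
    then obtain w where w: "w \<in> S" "(x, y) \<in> w" using X.basic_exists by blast
    then have "(f x, f x) \<in> \<phi> w" using fw' xy by metis
    then have "\<phi> w \<subseteq> Id" using Y.basic_subset_Id[OF image_basic[OF w(1)]] by blast
    then show "x = y" using image_subset_Id[OF w(1)] w(2) by blast
  qed
  moreover have "f \<alpha> = \<alpha>'" using fw'[OF assms(1)] assms(2) by blast
  ultimately show ?thesis using that f fw' by blast
qed

end


text \<open>Inclusions suffice: a pair of \<open>\<phi> u\<close> comes from a pair of some
  \<open>v\<close>, so \<open>\<phi> v\<close> meets \<open>\<phi> u\<close> and
  \<open>v = u\<close>.\<close>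

lemma (in algebraic_iso) induced_by_bijection:
  assumes f: "bij_betw f \<Omega> \<Omega>'" and fw: "\<And>x y w. \<lbrakk>w \<in> S; (x, y) \<in> w\<rbrakk> \<Longrightarrow> (f x, f y) \<in> \<phi> w"
    and u: "u \<in> S"
  shows "map_prod f f ` u = \<phi> u"
proof (intro equalityI subsetI)
  fix p assume "p \<in> map_prod f f ` u"
  then show "p \<in> \<phi> u" using fw[OF u] by auto
next
  fix p assume p: "p \<in> \<phi> u"
  then have "p \<in> \<Omega>' \<times> \<Omega>'" using Y.basic_subset[OF image_basic[OF u]] by blast
  then obtain x y where xy: "x \<in> \<Omega>" "y \<in> \<Omega>" "p = (f x, f y)"
    using bij_betw_imp_surj_on[OF f] by (cases p) blast
  then obtain v where v: "v \<in> S" "(x, y) \<in> v" using X.basic_exists by blast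
  have "\<phi> v = \<phi> u"
    using Y.basic_unique[OF image_basic[OF v(1)] image_basic[OF u]] fw[OF v] p xy(3) by blast
  then have "v = u" using basic_inj v(1) u by blast
  then show "p \<in> map_prod f f ` u" using v(2) xy(3) by force
qed

section \<open>Quasi-thin schemes\<close>

context scheme
begin

lemma points_nonempty: "\<Omega> \<noteq> {}"
  using basic_nonempty[OF diagonal_basic] by blast

lemma card_row_eq:
  assumes "u \<in> S" "a \<in> \<Omega>" "b \<in> \<Omega>"
  shows "card (u `` {a}) = card (u `` {b})"
  using card_row[OF assms(1) diagonal_basic, of a] card_row[OF assms(1) diagonal_basic, of b] assms(2,3)
  by (simp add: Id_on_iff)

lemma card_row_valency:
  assumes u: "u \<in> S" and a: "a \<in> \<Omega>"
  shows "card (u `` {a}) = valency u"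
proof -
  obtain x y where xy: "(x, y) \<in> u" using basic_nonempty[OF u] by auto
  have "card (u `` {b}) = card (u `` {a})" if "b \<in> Domain u" for b
    using card_row_eq[OF u _ a] basic_subset[OF u] that by blast
  then have "valency u = card (u `` {a})"
    unfolding valency_def using xy by (intro the_equality) (auto simp: Domain_iff)
  then show ?thesis by simp
qed

text \<open>Once an automorphism has put the first point of a pair in place, \<open>\<sigma>\<close>
  interchanges the possible second points.\<close>

lemma row_swap:
  assumes qt: "quasi_thin S" and a: "a \<in> \<Omega>"
  obtains \<sigma> where "bij_betw \<sigma> \<Omega> \<Omega>"
    "\<And>r z. \<lbrakk>r \<in> S; (a, z) \<in> r\<rbrakk> \<Longrightarrow> r `` {a} = {z, \<sigma> z}"
    "\<And>u x y. \<lbrakk>u \<in> S; (x, y) \<in> u\<rbrakk> \<Longrightarrow> (\<sigma> x, \<sigma> y) \<in> u"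
proof -
  have "\<exists>z'. \<forall>r \<in> S. (a, z) \<in> r \<longrightarrow> r `` {a} = {z, z'}" if z: "z \<in> \<Omega>" for z
  proof -
    obtain r where r: "r \<in> S" "(a, z) \<in> r" using basic_exists a z by blast
    have "card (r `` {a}) \<in> {1, 2}" using card_row_valency[OF r(1) a] qt r(1)
      unfolding quasi_thin_def by simp
    moreover have "z \<in> r `` {a}" using r(2) by blast
    \<comment> \<open>For a row with a single point this yields \<open>z' = z\<close>, so
      \<open>\<sigma>\<close> fixes that point.\<close>
    moreover have "\<exists>z'. R = {z, z'}" if "card R \<in> {1, 2}" "z \<in> R" for R
      using that by (auto simp: card_1_singleton_iff card_2_iff doubleton_eq_iff)
    ultimately have "\<exists>z'. r `` {a} = {z, z'}" by blast
    then show ?thesis using basic_unique r by metis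
  qed
  then obtain \<sigma> where \<sigma>: "\<And>z r. \<lbrakk>z \<in> \<Omega>; r \<in> S; (a, z) \<in> r\<rbrakk> \<Longrightarrow> r `` {a} = {z, \<sigma> z}"
    by metis
  have row: "\<exists>r \<in> S. r `` {a} = {z, \<sigma> z}" if z: "z \<in> \<Omega>" for z
    using basic_exists[OF a z] \<sigma>[OF z] by blast
  have \<sigma>\<Omega>: "\<sigma> z \<in> \<Omega>" if z: "z \<in> \<Omega>" for z
    using row[OF z] basic_subset by blast
  have invol: "\<sigma> (\<sigma> z) = z" if z: "z \<in> \<Omega>" for z
  proof -
    obtain r where r: "r \<in> S" "r `` {a} = {z, \<sigma> z}" using row[OF z] by blast
    then have "(a, \<sigma> z) \<in> r" by blast
    then have "{z, \<sigma> z} = {\<sigma> z, \<sigma> (\<sigma> z)}" using \<sigma>[OF \<sigma>\<Omega>[OF z] r(1)] r(2) by simp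
    then show ?thesis by (auto simp: doubleton_eq_iff)
  qed
  have bij: "bij_betw \<sigma> \<Omega> \<Omega>" by (rule bij_betwI[of _ _ _ \<sigma>]) (use \<sigma>\<Omega> invol in auto)
  have aut: "(\<sigma> x, \<sigma> y) \<in> u" if u: "u \<in> S" "(x, y) \<in> u" for u x y
  proof -
    have \<Omega>: "x \<in> \<Omega>" "y \<in> \<Omega>" using u basic_subset by blast+
    obtain r where r: "r \<in> S" "r `` {a} = {x, \<sigma> x}" using row[OF \<Omega>(1)] by blast
    obtain s where s: "s \<in> S" "s `` {a} = {y, \<sigma> y}" using row[OF \<Omega>(2)] by blast
    have s': "(a, y) \<in> s" "(a, \<sigma> y) \<in> s" and r': "(a, x) \<in> r" "(a, \<sigma> x) \<in> r" using r s by blast+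
    have "\<exists>b. (a, b) \<in> r \<and> (b, \<sigma> y) \<in> u"
      using path_exists[OF r(1) u(1) s(1) r'(1) u(2) s'] .
    then obtain b where "b \<in> r `` {a}" "(b, \<sigma> y) \<in> u" by blast
    then have 1: "(x, \<sigma> y) \<in> u \<or> (\<sigma> x, \<sigma> y) \<in> u" unfolding r(2) by blast
    have "\<exists>b. (a, b) \<in> s \<and> (b, \<sigma> x) \<in> u\<inverse>"
      by (rule path_exists[OF s(1) transpose_closed[OF u(1)] r(1) s'(1) _ r']) (use u(2) in blast)
    then obtain b where "b \<in> s `` {a}" "(\<sigma> x, b) \<in> u" by blast
    then have 2: "(\<sigma> x, y) \<in> u \<or> (\<sigma> x, \<sigma> y) \<in> u" unfolding s(2) by blast
    have card: "card (r `` {a} \<inter> u\<inverse> `` {y}) = card (r `` {a} \<inter> u\<inverse> `` {\<sigma> y})"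
      by (rule card_path_eq[OF r(1) u(1) s(1) s'])
    \<comment> \<open>If \<open>(\<sigma> x, \<sigma> y)\<close> were not in \<open>u\<close>, fact
      \<open>2\<close> would put \<open>(\<sigma> x, y)\<close> there. Then the whole row of
      \<open>r\<close> precedes \<open>y\<close> under \<open>u\<close>, but
      \<open>\<sigma> x\<close> does not precede \<open>\<sigma> y\<close>, against the equal counts
      in \<open>card\<close>.\<close>
    show ?thesis
    proof (rule ccontr)
      assume "(\<sigma> x, \<sigma> y) \<notin> u"
      then have "u\<inverse> `` {\<sigma> y} \<inter> {x, \<sigma> x} \<subset> {x, \<sigma> x}" "{x, \<sigma> x} \<inter> u\<inverse> `` {y} = {x, \<sigma> x}"
        using u(2) 2 by auto
      then have "card ({x, \<sigma> x} \<inter> u\<inverse> `` {\<sigma> y}) < card ({x, \<sigma> x} \<inter> u\<inverse> `` {y})"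
        by (metis Int_commute finite.emptyI finite_insert psubset_card_mono)
      then show False using card unfolding r(2) by simp
    qed
  qed
  show ?thesis
  proof (rule that[OF bij _ aut])
    fix r z assume r: "r \<in> S" "(a, z) \<in> r"
    then have "z \<in> \<Omega>" using basic_subset by blast
    then show "r `` {a} = {z, \<sigma> z}" using \<sigma> r by blast
  qed
qed

text \<open>The rows of one point partition \<Omega>. Written through intersection numbers, the
  number of points becomes an invariant of algebraic isomorphism.\<close>

lemma card_points: "card \<Omega> = (\<Sum>u\<in>S. intersection_number u (u\<inverse>) (Id_on \<Omega>))"
proof -
  obtain a where a: "a \<in> \<Omega>" using points_nonempty by blast
  have fin: "finite S" using finite_elements[OF _ partition] finite_points by blast
  have "\<Omega> = (\<Union>u\<in>S. u `` {a})" using basic_exists[OF a] basic_subset by blast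
  then have "card \<Omega> = card (\<Union>u\<in>S. u `` {a})" by simp
  also have "\<dots> = (\<Sum>u\<in>S. card (u `` {a}))"
  proof (rule card_UN_disjoint[OF fin])
    show "\<forall>u\<in>S. \<forall>v\<in>S. u \<noteq> v \<longrightarrow> u `` {a} \<inter> v `` {a} = {}" using basic_unique by blast
  qed (use finite_row in blast)
  also have "\<dots> = (\<Sum>u\<in>S. intersection_number u (u\<inverse>) (Id_on \<Omega>))"
    using card_row[OF _ diagonal_basic] a by (intro sum.cong) (auto simp: Id_on_iff)
  finally show ?thesis .
qed

end

text \<open>Separability ranges over coherent targets, the extension hypothesis over schemes; this
  bridges the two. A target relation meeting the diagonal is the image of a basic relation inside
  \<open>Id\<close>, and a scheme has only one of these.\<close>

lemma (in algebraic_iso) scheme_image: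
  assumes "scheme \<Omega> S"
  shows "\<phi> (Id_on \<Omega>) = Id_on \<Omega>'" "scheme \<Omega>' S'"
proof -
  interpret X': scheme \<Omega> S by fact
  have Id: "\<phi> (Id_on \<Omega>) \<subseteq> Id" unfolding image_subset_Id[OF X'.diagonal_basic] by blast
  show eq: "\<phi> (Id_on \<Omega>) = Id_on \<Omega>'"
  proof (rule equalityI)
    show "\<phi> (Id_on \<Omega>) \<subseteq> Id_on \<Omega>'"
      using Id Y.basic_subset[OF image_basic[OF X'.diagonal_basic]] by (auto simp: Id_on_def)
    show "Id_on \<Omega>' \<subseteq> \<phi> (Id_on \<Omega>)"
    proof
      fix p assume "p \<in> Id_on \<Omega>'"
      then obtain x where x: "x \<in> \<Omega>'" "p = (x, x)" by auto
      then obtain w where w: "w \<in> S" "(x, x) \<in> \<phi> w"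
        using Y.basic_exists[OF x(1) x(1)] preimage_basic by blast
      have "\<phi> w \<subseteq> Id" using Y.basic_subset_Id[OF image_basic[OF w(1)] w(2)] by blast
      then have "w \<subseteq> Id" unfolding image_subset_Id[OF w(1)] .
      then have "w \<subseteq> Id_on \<Omega>" using X.basic_subset[OF w(1)] by (auto simp: Id_on_def)
      then have "w = Id_on \<Omega>"
        using X.basic_unique[OF w(1) X'.diagonal_basic] X.basic_nonempty[OF w(1)] by blast
      then show "p \<in> \<phi> (Id_on \<Omega>)" using w(2) x(2) by simp
    qed
  qed
  have "Id_on \<Omega>' \<in> S'" using image_basic[OF X'.diagonal_basic] eq by simp
  then show "scheme \<Omega>' S'"
    by (intro scheme.intro scheme_axioms.intro Y.coherent_configuration_axioms)
qed

lemma (in algebraic_iso) card_points_eq: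
  assumes "scheme \<Omega> S"
  shows "card \<Omega>' = card \<Omega>"
proof -
  interpret X': scheme \<Omega> S by fact
  interpret Y': scheme \<Omega>' S' by (rule scheme_image(2)[OF assms])
  have "card \<Omega>' = (\<Sum>u\<in>S. intersection_number (\<phi> u) ((\<phi> u)\<inverse>) (Id_on \<Omega>'))"
    unfolding Y'.card_points by (rule sum.reindex_bij_betw[OF bij, symmetric])
  also have "\<dots> = (\<Sum>u\<in>S. intersection_number u (u\<inverse>) (Id_on \<Omega>))"
  proof (rule sum.cong[OF refl])
    fix u assume u: "u \<in> S"
    show "intersection_number (\<phi> u) ((\<phi> u)\<inverse>) (Id_on \<Omega>') = intersection_number u (u\<inverse>) (Id_on \<Omega>)"
      using number_eq[OF u X.transpose_closed[OF u] X'.diagonal_basic]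
      unfolding image_converse[OF u] scheme_image(1)[OF assms] .
  qed
  finally show ?thesis unfolding X'.card_points .
qed

text \<open>A point map realising \<psi> also induces \<phi>: the basic relation of \<open>T\<close>
  at a pair of \<open>u\<close> lies inside \<open>u\<close>, so its image under \<psi> lies inside
  \<open>\<phi> u\<close>.\<close>

lemma one_point_extension_induced:
  assumes X: "scheme \<Omega> S" and Y: "scheme \<Omega>' S'" and qt: "quasi_thin S"
    and iso: "algebraic_isomorphism S S' \<phi>" and \<alpha>: "\<alpha> \<in> \<Omega>" "\<alpha>' \<in> \<Omega>'"
    and ext: "one_point_extension \<Omega> S \<Omega>' S' \<phi> \<alpha> \<alpha>' \<psi>"
  shows "\<exists>f. bij_betw f \<Omega> \<Omega>' \<and> f \<alpha> = \<alpha>' \<and> (\<forall>u \<in> S. map_prod f f ` u = \<phi> u)"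
proof -
  interpret X: scheme \<Omega> S by fact
  interpret Y: scheme \<Omega>' S' by fact
  interpret \<phi>: algebraic_iso \<Omega> S \<Omega>' S' \<phi> by unfold_locales (rule iso)
  define T where "T = point_extension \<Omega> S \<alpha>"
  define T' where "T' = point_extension \<Omega>' S' \<alpha>'"
  have T: "point_fixing_refinement \<Omega> S \<alpha> T"
    unfolding T_def by (rule point_extension(1)[OF X.coherent_configuration_axioms \<alpha>(1)])
  have T': "point_fixing_refinement \<Omega>' S' \<alpha>' T'"
    unfolding T'_def by (rule point_extension(1)[OF Y.coherent_configuration_axioms \<alpha>(2)])
  interpret T: coherent_configuration \<Omega> T using T unfolding point_fixing_refinement_def by blast
  interpret T': coherent_configuration \<Omega>' T' using T' unfolding point_fixing_refinement_def by blast
  have ext': "algebraic_isomorphism T T' \<psi>" "\<psi> {(\<alpha>, \<alpha>)} = {(\<alpha>', \<alpha>')}"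
    "\<And>u v. \<lbrakk>u \<in> T; v \<in> S; u \<subseteq> v\<rbrakk> \<Longrightarrow> \<psi> u \<subseteq> \<phi> v"
    using ext unfolding one_point_extension_def T_def T'_def by blast+
  interpret \<psi>: algebraic_iso \<Omega> T \<Omega>' T' \<psi> by unfold_locales (rule ext'(1))
  have refine: "w \<subseteq> u" if "w \<in> T" "u \<in> S" "p \<in> w" "p \<in> u" for w u p
    using T that unfolding point_fixing_refinement_def is_union_of_iff[OF T.partition] by blast
  \<comment> \<open>Rows of \<open>T\<close> at \<alpha> lie in rows of \<open>S\<close>, which
    quasi-thinness bounds by two.\<close>
  have rows: "card (w `` {\<alpha>}) \<le> 2" if w: "w \<in> T" for w
  proof (cases "w `` {\<alpha>} = {}")
    case False
    then obtain z where z: "(\<alpha>, z) \<in> w" by blast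
    then have "z \<in> \<Omega>" using T.basic_subset w by blast
    then obtain u where u: "u \<in> S" "(\<alpha>, z) \<in> u" using X.basic_exists \<alpha>(1) by blast
    have "card (w `` {\<alpha>}) \<le> card (u `` {\<alpha>})"
      using refine[OF w u(1) z u(2)] X.finite_row[OF u(1)] by (intro card_mono) auto
    also have "\<dots> \<le> 2"
      using X.card_row_valency[OF u(1) \<alpha>(1)] qt u(1) unfolding quasi_thin_def by fastforce
    finally show ?thesis .
  qed simp
  have "{(\<alpha>, \<alpha>)} \<in> T" using T unfolding point_fixing_refinement_def by blast
  from \<psi>.realize[OF this ext'(2) rows] obtain f where f: "f ` \<Omega> \<subseteq> \<Omega>'" "inj_on f \<Omega>" "f \<alpha> = \<alpha>'"
    and fw: "\<And>x y w. \<lbrakk>w \<in> T; (x, y) \<in> w\<rbrakk> \<Longrightarrow> (f x, f y) \<in> \<psi> w"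
    by metis
  \<comment> \<open>An injection between finite sets of equal size is onto.\<close>
  have "f ` \<Omega> = \<Omega>'"
    using card_subset_eq[OF Y.finite_points f(1)] card_image[OF f(2)] \<phi>.card_points_eq[OF X] by simp
  then have bij: "bij_betw f \<Omega> \<Omega>'" using f(2) unfolding bij_betw_def by blast
  have "(f x, f y) \<in> \<phi> u" if u: "u \<in> S" "(x, y) \<in> u" for u x y
  proof -
    have "x \<in> \<Omega>" "y \<in> \<Omega>" using u X.basic_subset by blast+
    then obtain w where w: "w \<in> T" "(x, y) \<in> w" using T.basic_exists by blast
    have "\<psi> w \<subseteq> \<phi> u" by (rule ext'(3)[OF w(1) u(1) refine[OF w(1) u(1) w(2) u(2)]])
    then show ?thesis using fw[OF w] by blast
  qed
  then have "\<forall>u \<in> S. map_prod f f ` u = \<phi> u" using \<phi>.induced_by_bijection[OF bij] by blast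
  then show ?thesis using bij f(3) by blast
qed

section \<open>Transport along a bijection\<close>

context coherent_configuration
begin

lemma card_path_image:
  assumes g: "inj_on g \<Omega>" and u: "u \<in> S" "v \<in> S" and \<Omega>: "a \<in> \<Omega>" "c \<in> \<Omega>"
  shows "card ((map_prod g g ` u) `` {g a} \<inter> (map_prod g g ` v)\<inverse> `` {g c}) =
    card (u `` {a} \<inter> v\<inverse> `` {c})"
proof -
  have "(map_prod g g ` u) `` {g a} \<inter> (map_prod g g ` v)\<inverse> `` {g c} = g ` (u `` {a} \<inter> v\<inverse> `` {c})"
  proof (intro equalityI subsetI)
    fix y assume "y \<in> (map_prod g g ` u) `` {g a} \<inter> (map_prod g g ` v)\<inverse> `` {g c}"
    then obtain a' b b' c' where *: "(a', b) \<in> u" "(b', c') \<in> v" "g a' = g a" "g c' = g c"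
      "y = g b" "y = g b'"
      by (auto; metis)
    then have "a' \<in> \<Omega>" "b \<in> \<Omega>" "b' \<in> \<Omega>" "c' \<in> \<Omega>" using basic_subset u by blast+
    then have "a' = a" "c' = c" "b' = b" using * g \<Omega> by (metis inj_onD)+
    then show "y \<in> g ` (u `` {a} \<inter> v\<inverse> `` {c})" using * by blast
  qed force
  moreover have "u `` {a} \<inter> v\<inverse> `` {c} \<subseteq> \<Omega>" using basic_subset u by blast
  ultimately show ?thesis using card_image[OF inj_on_subset[OF g]] by metis
qed

text \<open>This copies a configuration onto another point set, possibly of another type, so that a
  target in the definition of separability can be moved to \<Omega>.\<close>

lemma transport:
  assumes g: "bij_betw g \<Omega> \<Omega>'"
  shows "coherent_configuration \<Omega>' ((`) (map_prod g g) ` S)"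
    and "algebraic_isomorphism S ((`) (map_prod g g) ` S) ((`) (map_prod g g))"
proof -
  let ?G = "(`) (map_prod g g)"
  have inj: "inj_on g \<Omega>" and img: "g ` \<Omega> = \<Omega>'" using g unfolding bij_betw_def by auto
  have injG: "inj_on (map_prod g g) (\<Omega> \<times> \<Omega>)" by (rule map_prod_inj_on[OF inj inj])
  have imgG: "map_prod g g ` (\<Omega> \<times> \<Omega>) = \<Omega>' \<times> \<Omega>'" using img by (rule map_prod_surj_on) (rule img)
  \<comment> \<open>One count serves twice: it makes the copy regular and identifies its
    intersection numbers.\<close>
  have card: "card (?G u `` {a'} \<inter> (?G v)\<inverse> `` {c'}) = intersection_number u v w"
    if uvw: "u \<in> S" "v \<in> S" "w \<in> S" "(a', c') \<in> ?G w" for u v w a' c'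
  proof -
    obtain a c where ac: "(a, c) \<in> w" "a' = g a" "c' = g c" using uvw(4) by auto
    then have "a \<in> \<Omega>" "c \<in> \<Omega>" using basic_subset uvw(3) by blast+
    then show ?thesis
      using card_path_image[OF inj uvw(1,2)] card_path[OF uvw(1-3) ac(1)] ac(2,3) by simp
  qed
  have part: "partition_on (\<Omega>' \<times> \<Omega>') (?G ` S)"
  proof -
    have "partition_on (map_prod g g ` (\<Omega> \<times> \<Omega>)) (?G ` S - {{}})"
      by (rule partition_on_inj_image[OF partition injG])
    moreover have "?G ` S - {{}} = ?G ` S" using basic_nonempty by auto
    ultimately show ?thesis unfolding imgG by simp
  qed
  show cc: "coherent_configuration \<Omega>' (?G ` S)"
  proof
    show "finite \<Omega>'" using finite_points img by blast
    show "partition_on (\<Omega>' \<times> \<Omega>') (?G ` S)" by (rule part)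
    obtain R where R: "R \<subseteq> S" "Id_on \<Omega> = \<Union>R" using diagonal unfolding is_union_of_def by blast
    have "Id_on \<Omega>' = ?G (Id_on \<Omega>)" unfolding img[symmetric] by (force simp: Id_on_def)
    also have "\<dots> = \<Union>(?G ` R)" unfolding R(2) by blast
    finally show "is_union_of (Id_on \<Omega>') (?G ` S)"
      unfolding is_union_of_def using image_mono[OF R(1)] by (intro exI[of _ "?G ` R"] conjI)
  next
    fix u assume "u \<in> ?G ` S"
    then obtain u0 where u0: "u0 \<in> S" "u = ?G u0" by blast
    then have "u\<inverse> = ?G (u0\<inverse>)" by force
    then show "u\<inverse> \<in> ?G ` S" using transpose_closed[OF u0(1)] by blast
  next
    fix u v w assume "u \<in> ?G ` S" "v \<in> ?G ` S" "w \<in> ?G ` S"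
    then obtain u0 v0 w0 where uvw: "u0 \<in> S" "v0 \<in> S" "w0 \<in> S" "u = ?G u0" "v = ?G v0" "w = ?G w0"
      by blast
    show "\<exists>n. \<forall>(\<alpha>, \<gamma>) \<in> w. card (u `` {\<alpha>} \<inter> v\<inverse> `` {\<gamma>}) = n"
      unfolding uvw(4-6) using card[OF uvw(1-3)] by blast
  qed
  interpret Y: coherent_configuration \<Omega>' "?G ` S" by (rule cc)
  have "inj_on ?G S"
    using inj_on_image_eq_iff[OF injG] basic_subset by (intro inj_onI) blast
  then have "bij_betw ?G S (?G ` S)" by (rule inj_on_imp_bij_betw)
  moreover have "intersection_number u v w = intersection_number (?G u) (?G v) (?G w)"
    if uvw: "u \<in> S" "v \<in> S" "w \<in> S" for u v w
  proof -
    obtain p where "p \<in> w" using basic_nonempty[OF uvw(3)] by blast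
    then obtain a c where ac: "(a, c) \<in> ?G w" by (cases p) force
    show ?thesis using card[OF uvw ac] Y.card_path[OF _ _ _ ac] uvw by simp
  qed
  ultimately show "algebraic_isomorphism S (?G ` S) ?G"
    unfolding algebraic_isomorphism_def by blast
qed

end

lemma algebraic_isomorphism_trans:
  assumes "algebraic_isomorphism S S' \<phi>" "algebraic_isomorphism S' S'' \<psi>"
  shows "algebraic_isomorphism S S'' (\<psi> \<circ> \<phi>)"
proof -
  have "\<phi> u \<in> S'" if "u \<in> S" for u
    using assms(1) that unfolding algebraic_isomorphism_def by (blast dest: bij_betwE)
  then show ?thesis
    using assms bij_betw_trans[of \<phi> S S' \<psi> S''] unfolding algebraic_isomorphism_def by simp
qed

section \<open>Schurity and separability\<close>

text \<open>Members of \<open>Bij\<close> are \<open>undefined\<close> off \<Omega>, as the elements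
  of \<open>BijGroup\<close> must be.\<close>

definition automorphisms :: "'a set \<Rightarrow> ('a \<times> 'a) set set \<Rightarrow> ('a \<Rightarrow> 'a) set" where
  "automorphisms \<Omega> S = {f \<in> Bij \<Omega>. \<forall>u \<in> S. map_prod f f ` u = u}"

context coherent_configuration
begin

lemma automorphisms_subgroup: "subgroup (automorphisms \<Omega> S) (BijGroup \<Omega>)"
proof -
  have comp: "map_prod (compose \<Omega> f g) (compose \<Omega> f g) ` u = map_prod f f ` map_prod g g ` u"
    if u: "u \<in> S" for u and f g :: "'a \<Rightarrow> 'a"
    unfolding image_image
  proof (rule image_cong[OF refl])
    fix p assume "p \<in> u"
    then have "p \<in> \<Omega> \<times> \<Omega>" using basic_subset[OF u] by blast
    then show "map_prod (compose \<Omega> f g) (compose \<Omega> f g) p = map_prod f f (map_prod g g p)"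
      by (cases p) (simp add: compose_eq)
  qed
  have one: "map_prod (\<lambda>x\<in>\<Omega>. x) (\<lambda>x\<in>\<Omega>. x) ` u = u" if u: "u \<in> S" for u
  proof -
    have "map_prod (\<lambda>x\<in>\<Omega>. x) (\<lambda>x\<in>\<Omega>. x) ` u = id ` u"
      by (rule image_cong[OF refl]) (use basic_subset[OF u] in auto)
    then show ?thesis by simp
  qed
  show ?thesis
  proof (rule group.subgroupI[OF group_BijGroup])
    show "automorphisms \<Omega> S \<subseteq> carrier (BijGroup \<Omega>)"
      unfolding automorphisms_def BijGroup_def by auto
    show "automorphisms \<Omega> S \<noteq> {}" using id_Bij one unfolding automorphisms_def by blast
  next
    fix f assume f: "f \<in> automorphisms \<Omega> S"
    let ?h = "\<lambda>x\<in>\<Omega>. inv_into \<Omega> f x"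
    have f': "f \<in> Bij \<Omega>" "\<And>u. u \<in> S \<Longrightarrow> map_prod f f ` u = u"
      using f unfolding automorphisms_def by auto
    \<comment> \<open>As \<open>f\<close> maps \<open>u\<close> onto itself, the image of
      \<open>u\<close> under \<open>?h\<close> equals its image under \<open>?h\<close> after
      \<open>f\<close>, which is the identity on \<Omega>.\<close>
    have "map_prod ?h ?h ` u = u" if u: "u \<in> S" for u
      using comp[OF u, of ?h f] unfolding Bij_compose_restrict_eq[OF f'(1)] f'(2)[OF u] one[OF u] by simp
    then show "inv\<^bsub>BijGroup \<Omega>\<^esub> f \<in> automorphisms \<Omega> S"
      unfolding inv_BijGroup[OF f'(1)] automorphisms_def using restrict_inv_into_Bij[OF f'(1)] by blast
  next
    fix f g assume "f \<in> automorphisms \<Omega> S" "g \<in> automorphisms \<Omega> S"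
    then show "f \<otimes>\<^bsub>BijGroup \<Omega>\<^esub> g \<in> automorphisms \<Omega> S"
      unfolding automorphisms_def BijGroup_def by (simp add: compose_Bij comp)
  qed
qed

text \<open>\<open>induced_by_bijection\<close> for the identity turns preservation into equality;
  restricting makes the map a member of \<open>Bij\<close>.\<close>

lemma automorphism_exists:
  assumes f: "bij_betw f \<Omega> \<Omega>" and pres: "\<And>u x y. \<lbrakk>u \<in> S; (x, y) \<in> u\<rbrakk> \<Longrightarrow> (f x, f y) \<in> u"
  shows "restrict f \<Omega> \<in> automorphisms \<Omega> S"
proof -
  have "bij_betw (restrict f \<Omega>) \<Omega> \<Omega>" using f bij_betw_cong[of \<Omega> "restrict f \<Omega>" f \<Omega>] by simp
  then have B: "restrict f \<Omega> \<in> Bij \<Omega>" unfolding Bij_def by simp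
  have "algebraic_isomorphism S S id" unfolding algebraic_isomorphism_def by simp
  then interpret id: algebraic_iso \<Omega> S \<Omega> S id by unfold_locales
  have "map_prod (restrict f \<Omega>) (restrict f \<Omega>) ` u = id u" if "u \<in> S" for u
  proof (rule id.induced_by_bijection[OF _ _ that])
    show "bij_betw (restrict f \<Omega>) \<Omega> \<Omega>" by fact
    fix x y w assume w: "w \<in> S" "(x, y) \<in> w"
    then have "x \<in> \<Omega>" "y \<in> \<Omega>" using basic_subset by blast+
    then show "(restrict f \<Omega> x, restrict f \<Omega> y) \<in> id w" using pres[OF w] by simp
  qed
  then show ?thesis using B unfolding automorphisms_def by simp
qed

text \<open>Automorphisms never leave a basic relation, so it is an orbit as soon as they act
  transitively on its pairs.\<close>

lemma schurianI:
  assumes "\<And>u x y x' y'. \<lbrakk>u \<in> S; (x, y) \<in> u; (x', y') \<in> u\<rbrakk> \<Longrightarrow>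
    \<exists>f. bij_betw f \<Omega> \<Omega> \<and> f x = x' \<and> f y = y' \<and> (\<forall>v \<in> S. \<forall>(a, b) \<in> v. (f a, f b) \<in> v)"
  shows "schurian \<Omega> S"
proof -
  let ?H = "BijGroup \<Omega>\<lparr>carrier := automorphisms \<Omega> S\<rparr>"
  have orbit: "orbit ?H (\<lambda>g. map_prod g g) (x, y) = u" if u: "u \<in> S" "(x, y) \<in> u" for u x y
  proof (intro equalityI subsetI)
    fix p assume "p \<in> orbit ?H (\<lambda>g. map_prod g g) (x, y)"
    then obtain g where g: "g \<in> automorphisms \<Omega> S" "p = map_prod g g (x, y)"
      unfolding orbit_def by auto
    have "map_prod g g ` u = u" using g(1) u(1) unfolding automorphisms_def by blast
    then show "p \<in> u" using g(2) u(2) by blast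
  next
    fix p assume p: "p \<in> u"
    obtain x' y' where p': "p = (x', y')" by (cases p)
    obtain f where f: "bij_betw f \<Omega> \<Omega>" "f x = x'" "f y = y'" "\<forall>v \<in> S. \<forall>(a, b) \<in> v. (f a, f b) \<in> v"
      using assms[OF u p[unfolded p']] by blast
    have "restrict f \<Omega> \<in> automorphisms \<Omega> S" using f(4) by (intro automorphism_exists[OF f(1)]) blast
    moreover have "p = map_prod (restrict f \<Omega>) (restrict f \<Omega>) (x, y)"
    proof -
      have "x \<in> \<Omega>" "y \<in> \<Omega>" using u basic_subset by blast+
      then show ?thesis using f(2,3) p' by simp
    qed
    ultimately show "p \<in> orbit ?H (\<lambda>g. map_prod g g) (x, y)"
      unfolding orbit_def partial_object.simps(1) mem_Collect_eq by fastforce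
  qed
  have "S = orbits ?H (\<Omega> \<times> \<Omega>) (\<lambda>g. map_prod g g)"
  proof (intro equalityI subsetI)
    fix u assume u: "u \<in> S"
    then obtain x y where xy: "(x, y) \<in> u" using basic_nonempty by fast
    then have "(x, y) \<in> \<Omega> \<times> \<Omega>" using basic_subset u by blast
    then show "u \<in> orbits ?H (\<Omega> \<times> \<Omega>) (\<lambda>g. map_prod g g)"
      using orbit[OF u xy] unfolding orbits_def by blast
  next
    fix v assume "v \<in> orbits ?H (\<Omega> \<times> \<Omega>) (\<lambda>g. map_prod g g)"
    then obtain x y where xy: "x \<in> \<Omega>" "y \<in> \<Omega>" "v = orbit ?H (\<lambda>g. map_prod g g) (x, y)"
      unfolding orbits_def by auto
    then obtain u where "u \<in> S" "(x, y) \<in> u" using basic_exists by blast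
    then show "v \<in> S" using orbit xy(3) by simp
  qed
  then show ?thesis unfolding schurian_def using automorphisms_subgroup by blast
qed

end

theorem theorem6p5:
  fixes \<Omega> :: "'a set" and S :: "('a \<times> 'a) set set"
  assumes "scheme \<Omega> S"
    and "quasi_thin S"
    and "card (orthogonals \<Omega> S) \<ge> 2"
    and "\<And>(\<Omega>' :: 'a set) S' \<phi> \<alpha> \<alpha>'.
      \<lbrakk>scheme \<Omega>' S'; algebraic_isomorphism S S' \<phi>; \<alpha> \<in> \<Omega>; \<alpha>' \<in> \<Omega>'\<rbrakk> \<Longrightarrow>
        \<exists>\<psi>. one_point_extension \<Omega> S \<Omega>' S' \<phi> \<alpha> \<alpha>' \<psi>"
  shows "schurian \<Omega> S \<and> separable TYPE('b) \<Omega> S"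
proof
  interpret X: scheme \<Omega> S by fact
  have induced: "\<exists>f. bij_betw f \<Omega> \<Omega>' \<and> f \<alpha> = \<alpha>' \<and> (\<forall>u \<in> S. map_prod f f ` u = \<phi> u)"
    if "scheme \<Omega>' S'" "algebraic_isomorphism S S' \<phi>" "\<alpha> \<in> \<Omega>" "\<alpha>' \<in> \<Omega>'"
    for \<Omega>' :: "'a set" and S' \<phi> \<alpha> \<alpha>'
    using assms(4)[OF that] one_point_extension_induced[OF assms(1) that(1) assms(2) that(2-4)] by blast
  have id: "algebraic_isomorphism S S id" unfolding algebraic_isomorphism_def by simp
  show "schurian \<Omega> S"
  proof (rule X.schurianI)
    fix u x y x' y' assume u: "u \<in> S" "(x, y) \<in> u" "(x', y') \<in> u"
    then have \<Omega>: "x \<in> \<Omega>" "x' \<in> \<Omega>" using X.basic_subset by blast+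
    \<comment> \<open>Extending the identity at \<open>(x, x')\<close> gives an automorphism taking
      \<open>x\<close> to \<open>x'\<close>.\<close>
    obtain f where f: "bij_betw f \<Omega> \<Omega>" "f x = x'" "\<And>v. v \<in> S \<Longrightarrow> map_prod f f ` v = v"
      using induced[OF assms(1) id \<Omega>] by auto
    have fv: "(f a, f b) \<in> v" if "v \<in> S" "(a, b) \<in> v" for v a b
      using f(3)[OF that(1)] that(2) by (metis imageI map_prod_simp)
    obtain \<sigma> where \<sigma>: "bij_betw \<sigma> \<Omega> \<Omega>" "\<And>r z. \<lbrakk>r \<in> S; (x', z) \<in> r\<rbrakk> \<Longrightarrow> r `` {x'} = {z, \<sigma> z}"
      "\<And>u a b. \<lbrakk>u \<in> S; (a, b) \<in> u\<rbrakk> \<Longrightarrow> (\<sigma> a, \<sigma> b) \<in> u"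
      using X.row_swap[OF assms(2) \<Omega>(2)] by metis
    have "(x', f y) \<in> u" using fv[OF u(1,2)] f(2) by simp
    \<comment> \<open>Both \<open>f y\<close> and \<open>y'\<close> lie in the row of
      \<open>x'\<close> by \<open>u\<close>, so they agree up to \<open>\<sigma>\<close>.\<close>
    then have "y' \<in> {f y, \<sigma> (f y)}" using \<sigma>(2)[OF u(1)] u(3) by blast
    then consider "y' = f y" | "y' = \<sigma> (f y)" by blast
    then show "\<exists>f. bij_betw f \<Omega> \<Omega> \<and> f x = x' \<and> f y = y' \<and> (\<forall>v \<in> S. \<forall>(a, b) \<in> v. (f a, f b) \<in> v)"
    proof cases
      case 1
      then show ?thesis using f(1,2) fv by blast
    next
      case 2
      \<comment> \<open>The diagonal row of \<open>x'\<close> is \<open>{x'}\<close>, so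
        \<open>\<sigma>\<close> fixes \<open>x'\<close> and following \<open>f\<close> by
        \<open>\<sigma>\<close> still takes \<open>x\<close> to \<open>x'\<close>.\<close>
      have "(x', x') \<in> Id_on \<Omega>" using \<Omega> by blast
      then have "Id_on \<Omega> `` {x'} = {x', \<sigma> x'}" by (rule \<sigma>(2)[OF X.diagonal_basic])
      then have "\<sigma> x' = x'" by blast
      moreover have "bij_betw (\<sigma> \<circ> f) \<Omega> \<Omega>" by (rule bij_betw_trans[OF f(1) \<sigma>(1)])
      moreover have "\<forall>v \<in> S. \<forall>(a, b) \<in> v. ((\<sigma> \<circ> f) a, (\<sigma> \<circ> f) b) \<in> v" using fv \<sigma>(3) by auto
      ultimately show ?thesis using f(2) 2 by (intro exI[of _ "\<sigma> \<circ> f"]) auto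
    qed
  qed
  show "separable TYPE('b) \<Omega> S"
    unfolding separable_def
  proof (intro allI impI)
    fix \<Omega>' :: "'b set" and S' \<phi>
    assume Y: "coherent_configuration \<Omega>' S'" and iso: "algebraic_isomorphism S S' \<phi>"
    interpret Y: coherent_configuration \<Omega>' S' by fact
    interpret \<phi>: algebraic_iso \<Omega> S \<Omega>' S' \<phi> by unfold_locales (rule iso)
    \<comment> \<open>The extension hypothesis concerns targets with points of type
      \<open>'a\<close>. Since both point sets have the same size, the given target can be copied
      onto \<Omega> along any bijection \<open>g\<close>.\<close>
    obtain g where g: "bij_betw g \<Omega>' \<Omega>"
      using finite_same_card_bij[OF Y.finite_points X.finite_points \<phi>.card_points_eq[OF assms(1)]] by blast
    define h where "h = inv_into \<Omega>' g"
    have h: "bij_betw h \<Omega> \<Omega>'" unfolding h_def by (rule bij_betw_inv_into[OF g])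
    let ?G = "(`) (map_prod g g)"
    have iso': "algebraic_isomorphism S (?G ` S') (?G \<circ> \<phi>)"
      by (rule algebraic_isomorphism_trans[OF iso Y.transport(2)[OF g]])
    interpret Z: coherent_configuration \<Omega> "?G ` S'" by (rule Y.transport(1)[OF g])
    interpret \<chi>: algebraic_iso \<Omega> S \<Omega> "?G ` S'" "?G \<circ> \<phi>" by unfold_locales (rule iso')
    obtain \<alpha> where \<alpha>: "\<alpha> \<in> \<Omega>" using X.points_nonempty by blast
    \<comment> \<open>The copy is a scheme by \<open>scheme_image\<close>, so the composed
      isomorphism has one point extensions and is induced by some \<open>f\<close>; \<open>h\<close>
      then undoes the copying.\<close>
    obtain f where f: "bij_betw f \<Omega> \<Omega>" "\<forall>u \<in> S. map_prod f f ` u = (?G \<circ> \<phi>) u"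
      using induced[OF \<chi>.scheme_image(2)[OF assms(1)] iso' \<alpha> \<alpha>] by blast
    have hg: "h (g y) = y" if "y \<in> \<Omega>'" for y
      unfolding h_def using g that by (simp add: bij_betw_def)
    have "map_prod (h \<circ> f) (h \<circ> f) ` u = \<phi> u" if u: "u \<in> S" for u
    proof -
      have "map_prod (h \<circ> f) (h \<circ> f) ` u = map_prod h h ` ?G (\<phi> u)"
        unfolding map_prod.comp[symmetric] image_comp[symmetric] using f(2) u by simp
      also have "\<dots> = id ` \<phi> u"
        unfolding image_image
        by (rule image_cong[OF refl]) (use Y.basic_subset[OF \<phi>.image_basic[OF u]] hg in auto)
      finally show ?thesis by simp
    qed
    then show "\<exists>f. bij_betw f \<Omega> \<Omega>' \<and> (\<forall>u \<in> S. map_prod f f ` u = \<phi> u)"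
      using bij_betw_trans[OF f(1) h] by blast
  qed
qed

end
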